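(* For every $n\ge5$, the inclusions $\mathrm{cl}(\mathcal{CS}_+^n)\subseteq\mathcal{DNN}^n$ and $\mathcal{DNN}^{n*}\subseteq\mathcal{CS}_+^{n*}$ are strict.
   Context: $\mathcal S^d$ denotes the real symmetric $d\times d$ matrices with trace inner product $\langle X,Y\rangle=\mathrm{Tr}(XY)$, and $\mathcal S^d_+$ the positive semidefinite ones. $\mathcal{CS}_+^n$ is the set of $A\in\mathcal S^n$ for which there exist $d\ge1$ and $X_1,\dots,X_n\in\mathcal S^d_+$ with $A_{ij}=\langle X_i,X_j\rangle$ for all $i,j$. $\mathcal{DNN}^n$ is the cone of positive semidefinite matrices in $\mathcal S^n$ with nonnegative entries. $\mathrm{cl}$ is topological closure in $\mathcal S^n$. For a cone $\mathcal K\subseteq\mathcal S^n$, the dual cone is $\mathcal K^*=\{X\in\mathcal S^n:\langle X,Y\rangle\ge0\ \forall Y\in\mathcal K\}$; $\mathcal{CS}_+^{n*}$ and $\mathcal{DNN}^{n*}$ denote the duals of $\mathcal{CS}_+^n$ and $\mathcal{DNN}^n$. *)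

theory Defs
  imports "HOL-Analysis.Analysis" "Jordan_Normal_Form.Matrix"
begin

(* $ is kept for vec_nth only; with both readings A $ i $ j is ambiguous. *)
no_notation Matrix.vec_index (infixl "$" 100)

text \<open>
  Matrices of the fixed order $n$ are of type \<open>real^'n^'n\<close> with \<open>n = CARD('n)\<close>. The psd matrices
  whose Gram matrix is formed in the definition of \<open>CSP\<close> have an existentially quantified order
  \<open>d\<close>, so they are of the dimension-free type \<open>real mat\<close>, with \<open>carrier_mat d d\<close> fixing the order.
\<close>

definition sym_mats :: "(real^'n^'n) set" where
  "sym_mats = {A. Finite_Cartesian_Product.transpose A = A}"

definition psd :: "real^'n^'n \<Rightarrow> bool" where
  "psd A \<longleftrightarrow> A \<in> sym_mats \<and> (\<forall>x. 0 \<le> inner x (A *v x))"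

definition psd_mats :: "nat \<Rightarrow> real mat set" where
  "psd_mats d = {X \<in> carrier_mat d d.
     transpose_mat X = X \<and> (\<forall>v \<in> carrier_vec d. 0 \<le> scalar_prod v (X *\<^sub>v v))}"

definition mat_trace :: "real mat \<Rightarrow> real" where
  "mat_trace X = (\<Sum>k<dim_row X. X $$ (k, k))"

definition CSP :: "(real^'n^'n) set" where
  "CSP = {A \<in> sym_mats. \<exists>d\<ge>1. \<exists>X :: 'n \<Rightarrow> real mat.
     (\<forall>i. X i \<in> psd_mats d) \<and> (\<forall>i j. A $ i $ j = mat_trace (X i * X j))}"

definition DNN :: "(real^'n^'n) set" where
  "DNN = {A. psd A \<and> (\<forall>i j. 0 \<le> A $ i $ j)}"

text \<open>The dual is taken inside the space of symmetric matrices, not in all of \<open>real^'n^'n\<close>.\<close>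

definition dual_cone :: "(real^'n^'n) set \<Rightarrow> (real^'n^'n) set" where
  "dual_cone K = {X \<in> sym_mats. \<forall>Y \<in> K. 0 \<le> trace (X ** Y)}"

text \<open>
  Since \<open>sym_mats\<close> is a closed subspace, the closure of a set of symmetric matrices in it is the
  closure in \<open>real^'n^'n\<close>, so \<open>closure\<close> is used for the topological closure.
\<close>

end

theory Submission
  imports Defs "Jordan_Normal_Form.Jordan_Normal_Form_Existence"
    "Jordan_Normal_Form.Jordan_Normal_Form_Uniqueness"
begin

(* The additional imports reintroduce this notation. *)
no_notation Matrix.vec_index (infixl "$" 100)

text \<open>
  Both strict inclusions follow from one symmetric matrix \<open>T\<close> that is nonnegative on \<open>CSP\<close> and
  negative on some \<open>A \<in> DNN\<close>. The matrix \<open>A\<close> is the Gram matrix of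
  \<open>u = (2,1,0)\<close>, \<open>v = (2,-1,0)\<close>, \<open>c = (0,0,8)\<close>, \<open>p = (4,-8,8)\<close>, \<open>q = (4,8,8)\<close>.
  They satisfy \<open>3u + p = 5v + c\<close> and \<open>3v + q = 5u + c\<close>, while \<open>c\<close> and \<open>p\<close> are orthogonal to \<open>u\<close>,
  and \<open>c\<close> and \<open>q\<close> are orthogonal to \<open>v\<close>. If psd matrices \<open>U, V, C, P, Q\<close> had this Gram matrix, the
  linear relations would carry over and orthogonality would make the products vanish, so
  multiplying by \<open>U\<close> and \<open>V\<close> gives \<open>3 U\<^sup>2 = 5 V U\<close> and \<open>3 V\<^sup>2 = 5 U V\<close>. Transposing the first
  equation, \<open>U\<^sup>2 = V\<^sup>2\<close>, hence \<open>U = V\<close>, contradicting \<open>u \<noteq> v\<close>.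

  To make this robust, uniformly in the order \<open>d\<close>, one tests against the sign \<open>S\<close> of \<open>U - V\<close>: the
  Powers--Stormer inequality gives \<open>Tr (U - V)\<^sup>2 \<le> Tr S(U\<^sup>2 - V\<^sup>2)\<close>, and the errors \<open>Tr S X Y\<close> are
  controlled by \<open>2 l |Tr S X Y| \<le> l\<^sup>2 Tr X Y + (Tr X\<^sup>2 + Tr Y\<^sup>2) / 2\<close> for psd \<open>X, Y\<close>. The resulting
  inequality is linear in the Gram matrix, and \<open>l = 10\<close> yields \<open>T\<close>.
\<close>

section \<open>Diagonalization of real symmetric matrices\<close>

lemma scalar_prod_self_eq_0_iff:
  fixes v :: "real vec"
  assumes "v \<in> carrier_vec n"
  shows "scalar_prod v v = 0 \<longleftrightarrow> v = 0\<^sub>v n"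
proof
  assume "scalar_prod v v = 0"
  then have "\<forall>i<n. vec_index v i * vec_index v i = 0"
    using assms by (auto simp: scalar_prod_def sum_nonneg_eq_0_iff)
  then show "v = 0\<^sub>v n" using assms by auto
qed (use assms in auto)

lemma symmetric_mat_index:
  assumes "X \<in> carrier_mat d d" "transpose_mat X = X" "i < d" "j < d"
  shows "X $$ (i, j) = X $$ (j, i)"
  using assms by (metis carrier_matD index_transpose_mat(1))

text \<open>Let \<open>s\<close> be the Hermitian form of A at an eigenvector and \<open>N\<close>
  the squared norm of that vector. Then \<open>s = z N\<close>, and conjugation fixes
  \<open>s\<close> because A is real and symmetric, so z is a quotient of reals.\<close>

lemma symmetric_eigenvalue_real:
  fixes A :: "real mat"
  assumes A: "A \<in> carrier_mat n n" and sym: "transpose_mat A = A"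
    and ev: "eigenvalue (map_mat complex_of_real A) z"
  shows "z \<in> \<real>"
proof -
  obtain v where v: "v \<in> carrier_vec n" "v \<noteq> 0\<^sub>v n"
    and Av: "map_mat complex_of_real A *\<^sub>v v = z \<cdot>\<^sub>v v"
    using ev A unfolding eigenvalue_def eigenvector_def by auto
  let ?v = "vec_index v"
  define s where "s = (\<Sum>i<n. \<Sum>j<n. cnj (?v i) * of_real (A $$ (i,j)) * ?v j)"
  define N where "N = (\<Sum>i<n. (cmod (?v i))\<^sup>2)"
  have row: "(\<Sum>j<n. of_real (A $$ (i,j)) * ?v j) = z * ?v i" if "i < n" for i
  proof -
    have "vec_index (map_mat complex_of_real A *\<^sub>v v) i = z * ?v i"
      using v that by (simp add: Av)
    then show ?thesis
      using A v that by (simp add: scalar_prod_def lessThan_atLeast0)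
  qed
  have "s = (\<Sum>i<n. cnj (?v i) * (\<Sum>j<n. of_real (A $$ (i,j)) * ?v j))"
    by (simp add: s_def sum_distrib_left mult.assoc)
  also have "\<dots> = (\<Sum>i<n. z * of_real ((cmod (?v i))\<^sup>2))"
    by (intro sum.cong refl) (simp only: lessThan_iff row complex_norm_square, simp add: algebra_simps)
  finally have s: "s = z * of_real N" by (simp add: N_def sum_distrib_left)
  have "cnj s = (\<Sum>i<n. \<Sum>j<n. cnj (?v j) * of_real (A $$ (j,i)) * ?v i)"
    unfolding s_def cnj_sum using symmetric_mat_index[OF A sym]
    by (intro sum.cong refl) (simp add: mult_ac)
  also have "\<dots> = s" unfolding s_def by (rule sum.swap)
  finally have "s \<in> \<real>" by (simp add: Reals_cnj_iff)
  moreover have "N \<noteq> 0"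
  proof
    assume "N = 0"
    then have "\<forall>i<n. ?v i = 0" unfolding N_def by (simp add: sum_nonneg_eq_0_iff)
    then show False using v by auto
  qed
  moreover have "z = s / of_real N" using s \<open>N \<noteq> 0\<close> by simp
  ultimately show ?thesis by simp
qed

text \<open>All complex roots are real, so the complex factorization is the image of a real one, and
  the embedding of real into complex polynomials is injective.\<close>

lemma symmetric_char_poly_splits:
  fixes A :: "real mat"
  assumes A: "A \<in> carrier_mat n n" and sym: "transpose_mat A = A"
  shows "\<exists>es. char_poly A = (\<Prod>e\<leftarrow>es. [:- e, 1:])"
proof -
  interpret poly_hom: map_poly_inj_idom_hom complex_of_real ..
  let ?C = "map_mat complex_of_real A"
  have C: "?C \<in> carrier_mat n n" using A by simp
  obtain as where as: "char_poly ?C = (\<Prod>a\<leftarrow>as. [:- a, 1:])"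
    using char_poly_factorized[OF C] by auto
  have "a \<in> \<real>" if "a \<in> set as" for a
  proof -
    have "poly (char_poly ?C) a = 0"
      unfolding as poly_prod_list using that by (auto simp: prod_list_zero_iff)
    then show ?thesis
      using symmetric_eigenvalue_real[OF A sym] eigenvalue_root_char_poly[OF C] by blast
  qed
  then have re: "map (\<lambda>a. complex_of_real (Re a)) as = as"
    by (intro map_idI) (simp add: of_real_Re)
  have "map_poly complex_of_real (\<Prod>e\<leftarrow>map Re as. [:- e, 1:])
      = (\<Prod>a\<leftarrow>map (\<lambda>a. complex_of_real (Re a)) as. [:- a, 1:])"
    by (induction as) (simp_all add: poly_hom.hom_mult map_poly_pCons del: mult_pCons_left)
  also have "\<dots> = map_poly complex_of_real (char_poly A)"
    unfolding re using as of_real_hom.char_poly_hom[OF A] by metis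
  finally show ?thesis
    by (intro exI[of _ "map Re as"]) (metis poly_hom.eq_iff)
qed

text \<open>If M is symmetric and M^2 v = 0, then |M v|^2 = <M^2 v, v> = 0. This is what excludes
  Jordan blocks of size two or more.\<close>

lemma symmetric_dim_gen_eigenspace:
  fixes A :: "real mat"
  assumes A: "A \<in> carrier_mat n n" and sym: "transpose_mat A = A"
  shows "dim_gen_eigenspace A (e :: real) 2 = dim_gen_eigenspace A e 1"
proof -
  define M where "M = char_matrix A e"
  have M: "M \<in> carrier_mat n n" using A by (simp add: M_def)
  have MT: "transpose_mat M = M"
    using A symmetric_mat_index[OF A sym] by (intro eq_matI) (auto simp: M_def char_matrix_def)
  have "mat_kernel (M * M) = mat_kernel M"
  proof (intro equalityI subsetI)
    fix v assume "v \<in> mat_kernel (M * M)"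
    then have v: "v \<in> carrier_vec n" and MMv: "M * M *\<^sub>v v = 0\<^sub>v n"
      using mat_kernelD[OF mult_carrier_mat[OF M M]] by auto
    have "scalar_prod (M *\<^sub>v v) (M *\<^sub>v v) = scalar_prod (M *\<^sub>v (M *\<^sub>v v)) v"
      using transpose_vec_mult_scalar[OF M v, of "M *\<^sub>v v"] M v
      by (simp only: MT mult_mat_vec_carrier[OF M v])
    also have "\<dots> = 0" using MMv M v assoc_mult_mat_vec[OF M M v] by (simp del: assoc_mult_mat_vec)
    finally have "M *\<^sub>v v = 0\<^sub>v n"
      using scalar_prod_self_eq_0_iff M v by (metis mult_mat_vec_carrier)
    then show "v \<in> mat_kernel M" using mat_kernelI[OF M v] by simp
  next
    fix v assume "v \<in> mat_kernel M"
    then show "v \<in> mat_kernel (M * M)" using mat_kernel_mult_subset[OF M M] by blast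
  qed
  moreover have "M ^\<^sub>m 2 = M * M" using M by (simp add: numeral_2_eq_2)
  moreover have "M ^\<^sub>m 1 = M" using M by simp
  ultimately show ?thesis
    using M unfolding dim_gen_eigenspace_def kernel_dim_def M_def by simp
qed

lemma jordan_matrix_blocks_1:
  assumes "\<forall>(k, a) \<in> set n_as. k = 1"
  shows "\<exists>b. jordan_matrix n_as = mat_diag (length n_as) b"
proof -
  have "jordan_matrix n_as = mat_diag (length n_as) (\<lambda>i. snd (n_as ! i))"
    using assms
  proof (induction n_as)
    case Nil
    show ?case by (rule eq_matI) (auto simp: jordan_matrix_def mat_diag_def)
  next
    case (Cons ka n_as)
    obtain a where ka: "ka = (1, a)" using Cons.prems by (cases ka) auto
    have "map fst n_as = map (\<lambda>_. 1) n_as" using Cons.prems by auto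
    then have "sum_list (map fst n_as) = length n_as" by (simp only: sum_list_triv) simp
    then show ?case using Cons unfolding ka jordan_matrix_Cons
      by (intro eq_matI) (auto simp: mat_diag_def nth_Cons')
  qed
  then show ?thesis by blast
qed

text \<open>The dimension of the kernel of (A - e)^k is the sum of min k s over the sizes s of the
  Jordan blocks for e. Equality for k = 1 and k = 2 leaves only blocks of size one. Similarity is
  enough below, so orthogonality of P is not pursued.\<close>

lemma symmetric_diagonalizable:
  fixes A :: "real mat"
  assumes A: "A \<in> carrier_mat n n" and sym: "transpose_mat A = A"
  obtains P Q b where "P \<in> carrier_mat n n" "Q \<in> carrier_mat n n"
    "P * Q = 1\<^sub>m n" "Q * P = 1\<^sub>m n" "A = P * mat_diag n b * Q"
proof -
  obtain n_as where jnf: "jordan_nf A n_as"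
    using symmetric_char_poly_splits[OF A sym] jordan_nf_exists[OF A] by blast
  have one: "k = 1" if ka: "(k, a) \<in> set n_as" for k a
  proof -
    define ks where "ks = map fst [(k, e)\<leftarrow>n_as. e = a]"
    have k: "k \<in> set ks" using ka by (force simp: ks_def)
    have "(\<Sum>k\<leftarrow>ks. min 2 k) = (\<Sum>k\<leftarrow>ks. min 1 k)"
      using symmetric_dim_gen_eigenspace[OF A sym, where e = a]
      unfolding dim_gen_eigenspace[OF jnf] ks_def .
    \<comment> \<open>No summment on the right exceeds its counterpart on the left, so equal sums
      force equality term by term.\<close>
    then have "min 2 k = min 1 k"
      using k
    proof (induction ks)
      case (Cons l ks)
      have "(\<Sum>k\<leftarrow>ks. min 1 k) \<le> (\<Sum>k\<leftarrow>ks. min 2 k)" by (rule sum_list_mono) simp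
      moreover have "min 1 l \<le> min 2 l" by simp
      moreover have "min 2 l + (\<Sum>k\<leftarrow>ks. min 2 k) = min 1 l + (\<Sum>k\<leftarrow>ks. min 1 k)"
        using Cons.prems by simp
      ultimately have "min 2 l = min 1 l" "(\<Sum>k\<leftarrow>ks. min 2 k) = (\<Sum>k\<leftarrow>ks. min 1 k)" by linarith+
      then show ?case using Cons by auto
    qed simp
    \<comment> \<open>Size zero would satisfy the equation too; the definition of
      \<open>jordan_nf\<close> forbids it.\<close>
    moreover have "k \<noteq> 0" using jnf ka by (force simp: jordan_nf_def)
    ultimately show "k = 1" by (simp add: min_def split: if_splits)
  qed
  then obtain b where b: "jordan_matrix n_as = mat_diag (length n_as) b"
    using jordan_matrix_blocks_1[of n_as] by blast
  obtain P Q where wit: "similar_mat_wit A (mat_diag (length n_as) b) P Q"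
    using jnf unfolding jordan_nf_def similar_mat_def b by blast
  note w = similar_mat_witD2[OF A wit]
  have "length n_as = n" using w(5) by (metis carrier_matD(1) mat_diag_dim)
  with w that[of P Q b] show thesis by simp
qed

section \<open>The trace and positive semidefinite matrices\<close>

lemma mat_trace_mult:
  assumes "X \<in> carrier_mat d d" "Y \<in> carrier_mat d d"
  shows "mat_trace (X * Y) = (\<Sum>i<d. \<Sum>j<d. X $$ (i,j) * Y $$ (j,i))"
  using assms by (simp add: mat_trace_def scalar_prod_def lessThan_atLeast0)

lemma mat_trace_commute:
  assumes "X \<in> carrier_mat d d" "Y \<in> carrier_mat d d"
  shows "mat_trace (X * Y) = mat_trace (Y * X)"
  unfolding mat_trace_mult[OF assms] mat_trace_mult[OF assms(2,1)]
  by (subst sum.swap) (simp add: mult.commute)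

lemma mat_trace_transpose:
  assumes "X \<in> carrier_mat d d"
  shows "mat_trace (transpose_mat X) = mat_trace X"
  using assms by (simp add: mat_trace_def)

lemma mat_trace_add:
  assumes "X \<in> carrier_mat d d" "Y \<in> carrier_mat d d"
  shows "mat_trace (X + Y) = mat_trace X + mat_trace Y"
  using assms by (simp add: mat_trace_def sum.distrib)

lemma mat_trace_minus:
  assumes "X \<in> carrier_mat d d" "Y \<in> carrier_mat d d"
  shows "mat_trace (X - Y) = mat_trace X - mat_trace Y"
  using assms by (simp add: mat_trace_def sum_subtractf)

lemma mat_trace_smult:
  assumes "X \<in> carrier_mat d d"
  shows "mat_trace (c \<cdot>\<^sub>m X) = c * mat_trace X"
  using assms by (simp add: mat_trace_def sum_distrib_left)

lemmas mat_trace_linear = mat_trace_add mat_trace_minus mat_trace_smult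

lemma mat_trace_gram:
  assumes "Z \<in> carrier_mat d d"
  shows "mat_trace (transpose_mat Z * Z) = (\<Sum>i<d. \<Sum>j<d. (Z $$ (j,i))\<^sup>2)"
  using assms by (subst mat_trace_mult[of _ d]) (auto simp: power2_eq_square)

lemma mat_trace_gram_nonneg:
  assumes "Z \<in> carrier_mat d d"
  shows "0 \<le> mat_trace (transpose_mat Z * Z)"
  unfolding mat_trace_gram[OF assms] by (intro sum_nonneg) auto

definition sym_carrier :: "nat \<Rightarrow> real mat set" where
  "sym_carrier d = {X \<in> carrier_mat d d. transpose_mat X = X}"

lemma sym_carrierD:
  assumes "X \<in> sym_carrier d"
  shows "X \<in> carrier_mat d d" "transpose_mat X = X"
  using assms by (auto simp: sym_carrier_def)

lemma psd_matsD:
  assumes "X \<in> psd_mats d"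
  shows "X \<in> sym_carrier d" "X \<in> carrier_mat d d"
  using assms by (auto simp: psd_mats_def sym_carrier_def)

lemma psd_mats_congruence:
  assumes X: "X \<in> psd_mats d" and P: "P \<in> carrier_mat d d"
  shows "transpose_mat P * X * P \<in> psd_mats d"
proof -
  note Xc = psd_matsD(2)[OF X] and XT = sym_carrierD(2)[OF psd_matsD(1)[OF X]]
  have "transpose_mat (transpose_mat P * X * P) = transpose_mat P * X * P"
    using P Xc XT by (simp add: transpose_mult[of _ d d _ d])
  moreover have "0 \<le> scalar_prod v (transpose_mat P * X * P *\<^sub>v v)" if v: "v \<in> carrier_vec d" for v
  proof -
    have "scalar_prod v (transpose_mat P * X * P *\<^sub>v v)
        = scalar_prod v (transpose_mat P *\<^sub>v (X *\<^sub>v (P *\<^sub>v v)))"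
      using P Xc v by (simp add: assoc_mult_mat_vec[of _ d d _ d])
    also have "\<dots> = scalar_prod (P *\<^sub>v v) (X *\<^sub>v (P *\<^sub>v v))"
      using transpose_vec_mult_scalar[of "transpose_mat P" d d "X *\<^sub>v (P *\<^sub>v v)" v] P Xc v by simp
    also have "\<dots> \<ge> 0"
      using X P v by (auto simp: psd_mats_def)
    finally show ?thesis .
  qed
  ultimately show ?thesis using P Xc by (auto simp: psd_mats_def)
qed

lemma mat_trace_psd_nonneg:
  assumes X: "X \<in> psd_mats d"
  shows "0 \<le> mat_trace X"
proof -
  have Xc: "X \<in> carrier_mat d d" by (rule psd_matsD[OF X])
  have "0 \<le> X $$ (i,i)" if i: "i < d" for i
  proof -
    have "0 \<le> scalar_prod (unit_vec d i) (X *\<^sub>v unit_vec d i)"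
      using X by (auto simp: psd_mats_def)
    also have "\<dots> = X $$ (i,i)"
      using Xc i by (simp add: scalar_prod_left_unit[of _ d])
    finally show ?thesis .
  qed
  then show ?thesis using Xc by (auto simp: mat_trace_def intro!: sum_nonneg)
qed


section \<open>Functional calculus\<close>

text \<open>The diagonalizing matrix \<open>P\<close> need not be orthogonal: the matrix \<open>P\<^sup>T P\<close> commutes with the
  diagonal matrix of the eigenvalues, hence with every function of it, and this is what makes
  \<open>F f = P f(diag b) P\<^sup>-\<^sup>1\<close> symmetric.\<close>

lemma symmetric_functional_calculus:
  assumes "A \<in> sym_carrier d"
  obtains F :: "(real \<Rightarrow> real) \<Rightarrow> real mat"
  where "\<And>f. F f \<in> sym_carrier d" "\<And>f g. F f * F g = F (\<lambda>x. f x * g x)"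
    "\<And>f g. F f + F g = F (\<lambda>x. f x + g x)" "\<And>f g. F f - F g = F (\<lambda>x. f x - g x)"
    "F (\<lambda>_. 1) = 1\<^sub>m d" "F (\<lambda>x. x) = A"
proof -
  note A = sym_carrierD(1)[OF assms] and sym = sym_carrierD(2)[OF assms]
  obtain P Q b where P: "P \<in> carrier_mat d d" and Q: "Q \<in> carrier_mat d d"
    and PQ: "P * Q = 1\<^sub>m d" and QP: "Q * P = 1\<^sub>m d" and A_eq: "A = P * mat_diag d b * Q"
    using symmetric_diagonalizable[OF A sym] by blast
  define D where "D f = mat_diag d (\<lambda>i. f (b i))" for f :: "real \<Rightarrow> real"
  define F where "F f = P * D f * Q" for f
  have D: "D f \<in> carrier_mat d d" for f by (simp add: D_def)
  have DT: "transpose_mat (D f) = D f" for f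
    by (intro eq_matI) (auto simp: D_def mat_diag_def)
  have F: "F f \<in> carrier_mat d d" for f using P Q D by (auto simp: F_def)
  note assoc = assoc_mult_mat[of _ d d _ d _ d]
  let ?PT = "transpose_mat P" and ?QT = "transpose_mat Q"
  have PT: "?PT \<in> carrier_mat d d" and QT: "?QT \<in> carrier_mat d d" using P Q by auto
  have PTQT: "?PT * ?QT = 1\<^sub>m d"
    using transpose_mult[OF Q P] QP by simp
  have QTPT: "?QT * ?PT = 1\<^sub>m d"
    using transpose_mult[OF P Q] PQ by simp
  have FT: "transpose_mat (F f) = ?QT * D f * ?PT" for f
    using P Q D[of f] DT[of f] assoc by (simp add: F_def transpose_mult[of _ d d _ d])
  define W where "W = ?PT * P"
  have W: "W \<in> carrier_mat d d" using P by (simp add: W_def)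
  \<comment> \<open>Symmetry of A, multiplied by \<open>?PT\<close> on the left and by P on the
    right, says that W commutes with the diagonal matrix of the eigenvalues.\<close>
  have "?QT * D (\<lambda>x. x) * ?PT = P * D (\<lambda>x. x) * Q"
    using sym A_eq FT[of "\<lambda>x. x"] by (simp add: F_def D_def)
  then have "?PT * (?QT * D (\<lambda>x. x) * ?PT) * P = ?PT * (P * D (\<lambda>x. x) * Q) * P" by simp
  moreover have "?PT * (?QT * D f * ?PT) * P = D f * W" for f
  proof -
    have "?PT * (?QT * D f * ?PT) * P = (?PT * ?QT) * (D f * W)"
      using PT QT P D[of f] by (simp add: W_def assoc)
    then show ?thesis using D[of f] W by (simp add: PTQT)
  qed
  moreover have "?PT * (P * D f * Q) * P = W * D f" for f
  proof -
    have "?PT * (P * D f * Q) * P = W * D f * (Q * P)"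
      using PT QT P Q D[of f] by (simp add: W_def assoc)
    then show ?thesis using D[of f] W by (simp add: QP)
  qed
  ultimately have comm: "D (\<lambda>x. x) * W = W * D (\<lambda>x. x)" by simp
  \<comment> \<open>Hence W has nonzero entries only between equal eigenvalues, where every f takes
    equal values.\<close>
  have entry: "b i * W $$ (i,j) = W $$ (i,j) * b j" if "i < d" "j < d" for i j
  proof -
    have "(D (\<lambda>x. x) * W) $$ (i,j) = (W * D (\<lambda>x. x)) $$ (i,j)" by (simp add: comm)
    then show ?thesis
      unfolding D_def mat_diag_mult_left[OF W] mat_diag_mult_right[OF W] using that by simp
  qed
  have commf: "D f * W = W * D f" for f
  proof (rule eq_matI)
    fix i j assume "i < dim_row (W * D f)" "j < dim_col (W * D f)"
    then have ij: "i < d" "j < d" using W D[of f] by auto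
    then have "f (b i) * W $$ (i,j) = W $$ (i,j) * f (b j)"
      using entry[OF ij] by (cases "b i = b j") auto
    then show "(D f * W) $$ (i,j) = (W * D f) $$ (i,j)"
      unfolding D_def mat_diag_mult_left[OF W] mat_diag_mult_right[OF W] using ij by simp
  qed (use W D[of f] in auto)
  have FT_eq: "transpose_mat (F f) = F f" for f
  proof -
    have "?QT * D f * ?PT = ?QT * (D f * W) * Q"
    proof -
      have "?QT * (D f * W) * Q = ?QT * D f * ?PT * (P * Q)"
        using PT QT P Q D[of f] by (simp add: W_def assoc)
      then show ?thesis using PT QT D[of f] by (simp add: PQ)
    qed
    also have "\<dots> = ?QT * ?PT * (P * D f * Q)"
      unfolding commf using PT QT P Q D[of f] by (simp add: W_def assoc)
    also have "\<dots> = F f"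
      using P Q D[of f] by (simp add: QTPT F_def)
    finally show ?thesis by (simp add: FT)
  qed
  show thesis
  proof (rule that[of F])
    show "F f \<in> sym_carrier d" for f using F FT_eq by (simp add: sym_carrier_def)
    show "F f * F g = F (\<lambda>x. f x * g x)" for f g
    proof -
      have "F f * F g = P * (D f * (Q * P) * D g) * Q"
        using P Q D[of f] D[of g] by (simp add: F_def assoc)
      also have "D f * (Q * P) * D g = D (\<lambda>x. f x * g x)"
        using right_mult_one_mat[OF D, of f] by (simp add: QP) (simp add: D_def)
      finally show ?thesis by (simp add: F_def)
    qed
    show "F f + F g = F (\<lambda>x. f x + g x)" for f g
    proof -
      have "D (\<lambda>x. f x + g x) = D f + D g" by (intro eq_matI) (auto simp: D_def mat_diag_def)
      then show ?thesis using P Q D[of f] D[of g]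
        by (simp add: F_def add_mult_distrib_mat[of _ d d _ _ d] mult_add_distrib_mat[of _ d d _ d])
    qed
    show "F f - F g = F (\<lambda>x. f x - g x)" for f g
    proof -
      have "D (\<lambda>x. f x - g x) = D f - D g" by (intro eq_matI) (auto simp: D_def mat_diag_def)
      then show ?thesis using P Q D[of f] D[of g]
        by (simp add: F_def minus_mult_distrib_mat[of _ d d _ _ d] mult_minus_distrib_mat[of _ d d _ d])
    qed
    show "F (\<lambda>_. 1) = 1\<^sub>m d" using P Q by (simp add: F_def D_def PQ)
    show "F (\<lambda>x. x) = A" by (simp add: F_def D_def A_eq)
  qed
qed

section \<open>Trace inequalities\<close>

lemma mat_trace_mult_sq_nonneg:
  assumes X: "X \<in> psd_mats d" and Z: "Z \<in> sym_carrier d"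
  shows "0 \<le> mat_trace (X * (Z * Z))"
proof -
  note Xc = psd_matsD(2)[OF X] and Zc = sym_carrierD(1)[OF Z]
  have "mat_trace (X * (Z * Z)) = mat_trace (Z * X * Z)"
    using mat_trace_commute[of "X * Z" d Z] Xc Zc by (simp add: assoc_mult_mat[of _ d d _ d _ d])
  then show ?thesis
    using mat_trace_psd_nonneg[OF psd_mats_congruence[OF X Zc]] sym_carrierD(2)[OF Z] by simp
qed

text \<open>It suffices to write Y as the square of a symmetric matrix. The functional calculus does
  not record the signs of the eigenvalues, so the negative part of Y is first shown to vanish, by a
  trace argument.\<close>

lemma mat_trace_psd_mult_nonneg:
  assumes X: "X \<in> psd_mats d" and Y: "Y \<in> psd_mats d"
  shows "0 \<le> mat_trace (X * Y)"
proof -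
  obtain F :: "(real \<Rightarrow> real) \<Rightarrow> real mat" where F: "\<And>f. F f \<in> sym_carrier d" "\<And>f g. F f * F g = F (\<lambda>x. f x * g x)"
    "\<And>f g. F f + F g = F (\<lambda>x. f x + g x)" "\<And>f g. F f - F g = F (\<lambda>x. f x - g x)"
    "F (\<lambda>_. 1) = 1\<^sub>m d" "F (\<lambda>x. x) = Y"
    using symmetric_functional_calculus[OF psd_matsD(1)[OF Y]] by blast
  note Fc = sym_carrierD(1)[OF F(1)] and FT = sym_carrierD(2)[OF F(1)]
  \<comment> \<open>\<open>m\<close> is the negative part, \<open>h\<close> its square root, and
    \<open>r\<close> the square root of the positive part.\<close>
  define m h r :: "real \<Rightarrow> real"
    where "m x = max (-x) 0" and "h x = sqrt (max (-x) 0)" and "r x = sqrt (max x 0)" for x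
  have F0: "F (\<lambda>_. 0) = 0\<^sub>m d d"
    using F(4)[of "\<lambda>_. 1" "\<lambda>_. 1"] by (simp add: F(5) minus_r_inv_mat[of _ d d])
  \<comment> \<open>Pointwise h x h = m x = -m^2. Both traces are nonnegative, the first because Y
    is psd, and they add up to zero; so the Frobenius norm of \<open>F m\<close> is zero.\<close>
  have "F h * Y * F h + F m * F m = F (\<lambda>x. h x * x * h x + m x * m x)"
    using F by metis
  also have "(\<lambda>x. h x * x * h x + m x * m x) = (\<lambda>_. 0)"
  proof
    fix x
    have "h x * h x = m x" by (simp add: h_def m_def)
    then have "h x * x * h x + m x * m x = m x * (x + m x)" by (simp add: algebra_simps)
    then show "h x * x * h x + m x * m x = 0" by (simp add: m_def max_def)
  qed
  finally have "mat_trace (F h * Y * F h + F m * F m) = 0"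
    using F0 by (simp add: mat_trace_def)
  then have "mat_trace (F h * Y * F h) + mat_trace (F m * F m) = 0"
    using Fc[of h] Fc[of m] psd_matsD(2)[OF Y] by (subst (asm) mat_trace_add[of _ d]) auto
  moreover have "0 \<le> mat_trace (F h * Y * F h)"
    using mat_trace_psd_nonneg[OF psd_mats_congruence[OF Y Fc]] FT by metis
  moreover have sq: "mat_trace (F m * F m) = (\<Sum>i<d. \<Sum>j<d. (F m $$ (j,i))\<^sup>2)"
    using mat_trace_gram[OF Fc, of m] FT[of m] by simp
  ultimately have "(\<Sum>i<d. \<Sum>j<d. (F m $$ (j,i))\<^sup>2) \<le> 0" by linarith
  moreover have "0 \<le> (\<Sum>i<d. \<Sum>j<d. (F m $$ (j,i))\<^sup>2)" by (intro sum_nonneg) auto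
  ultimately have "(\<Sum>i<d. \<Sum>j<d. (F m $$ (j,i))\<^sup>2) = 0" by linarith
  then have "\<forall>i<d. \<forall>j<d. F m $$ (j,i) = 0"
    by (simp add: sum_nonneg_eq_0_iff sum_nonneg)
  then have m0: "F m = 0\<^sub>m d d" using Fc[of m] by (intro eq_matI) auto
  have "Y = F (\<lambda>x. r x * r x - m x)"
  proof -
    have "(\<lambda>x. r x * r x - m x) = (\<lambda>x. x)" by (auto simp: r_def m_def max_def)
    then show ?thesis using F(6) by simp
  qed
  also have "\<dots> = F r * F r"
  proof -
    have "F (\<lambda>x. r x * r x) - F m = F (\<lambda>x. r x * r x)"
      unfolding m0 using Fc[of "\<lambda>x. r x * r x"] by (intro eq_matI) auto
    then show ?thesis using F(2)[of r r] F(4)[of "\<lambda>x. r x * r x" m] by simp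
  qed
  finally show ?thesis using mat_trace_mult_sq_nonneg[OF X F(1)] by metis
qed

section \<open>Linearity, rotation and reversal for traces of products\<close>

lemma mat_trace_mult_linear_left:
  assumes "X \<in> carrier_mat d d" "Z \<in> carrier_mat d d"
  shows "Y \<in> carrier_mat d d \<Longrightarrow> mat_trace ((X + Y) * Z) = mat_trace (X * Z) + mat_trace (Y * Z)"
    "Y \<in> carrier_mat d d \<Longrightarrow> mat_trace ((X - Y) * Z) = mat_trace (X * Z) - mat_trace (Y * Z)"
    "mat_trace ((c \<cdot>\<^sub>m X) * Z) = c * mat_trace (X * Z)"
  using assms by (simp_all add: add_mult_distrib_mat[of _ d d _ _ d]
      minus_mult_distrib_mat[of _ d d _ _ d] mat_trace_linear[of _ d] mult_smult_assoc_mat[of _ d d _ d])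

lemma mat_trace_mult_linear_right:
  assumes "X \<in> carrier_mat d d" "Z \<in> carrier_mat d d"
  shows "Y \<in> carrier_mat d d \<Longrightarrow> mat_trace (Z * (X + Y)) = mat_trace (Z * X) + mat_trace (Z * Y)"
    "Y \<in> carrier_mat d d \<Longrightarrow> mat_trace (Z * (X - Y)) = mat_trace (Z * X) - mat_trace (Z * Y)"
    "mat_trace (Z * (c \<cdot>\<^sub>m X)) = c * mat_trace (Z * X)"
  using assms by (simp_all add: mat_trace_commute[of Z d] mat_trace_mult_linear_left[of _ d]
      minus_carrier_mat)

lemmas mat_trace_mult_linear = mat_trace_mult_linear_left mat_trace_mult_linear_right

lemma mat_trace_rotate:
  assumes "X \<in> carrier_mat d d" "Y \<in> carrier_mat d d" "Z \<in> carrier_mat d d"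
  shows "mat_trace (X * (Y * Z)) = mat_trace (Y * (Z * X))"
  using mat_trace_commute[of X d "Y * Z"] assms by (simp add: assoc_mult_mat[of _ d d _ d _ d])

lemma mat_trace_reverse:
  assumes "X \<in> sym_carrier d" "Y \<in> sym_carrier d" "Z \<in> sym_carrier d"
  shows "mat_trace (X * (Y * Z)) = mat_trace (Z * (Y * X))"
  using assms[THEN sym_carrierD(1)] assms[THEN sym_carrierD(2)] mat_trace_transpose[of "X * (Y * Z)" d]
  by (simp add: transpose_mult[of _ d d _ d] assoc_mult_mat[of _ d d _ d _ d])

text \<open>Expand Tr Z^T Z >= 0 for Z = l X - Y S; the involution cancels in Tr S Y Y S. Either
  sign of l is allowed, so this bounds the absolute value of Tr S X Y.\<close>

lemma mat_trace_involution_le: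
  assumes X: "X \<in> sym_carrier d" and Y: "Y \<in> sym_carrier d" and S: "S \<in> sym_carrier d"
    and SS: "S * S = 1\<^sub>m d"
  shows "2 * l * mat_trace (S * (X * Y)) \<le> l\<^sup>2 * mat_trace (X * X) + mat_trace (Y * Y)"
proof -
  note c[simp] = sym_carrierD(1)[OF X] sym_carrierD(1)[OF Y] sym_carrierD(1)[OF S]
    mult_carrier_mat[of _ d d _ d] minus_carrier_mat[of _ d d]
  note assoc = assoc_mult_mat[of _ d d _ d _ d]
  define Z where "Z = l \<cdot>\<^sub>m X - Y * S"
  have Z: "Z \<in> carrier_mat d d" unfolding Z_def by (rule minus_carrier_mat[OF mult_carrier_mat[OF c(2,3)]])
  have ZT: "transpose_mat Z = l \<cdot>\<^sub>m X - S * Y"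
  proof -
    have "transpose_mat (l \<cdot>\<^sub>m X) = l \<cdot>\<^sub>m transpose_mat X" by (intro eq_matI) auto
    then show ?thesis using sym_carrierD(2)[OF X] sym_carrierD(2)[OF Y] sym_carrierD(2)[OF S]
      by (simp add: Z_def transpose_minus[of _ d d] transpose_mult[of _ d d _ d])
  qed
  have "mat_trace (S * (Y * (Y * S))) = mat_trace (Y * Y)"
  proof -
    have "mat_trace (S * (Y * (Y * S))) = mat_trace (Y * Y * S * S)"
      using mat_trace_commute[of S d "Y * Y * S"] by (simp add: assoc)
    also have "Y * Y * S * S = Y * Y" by (simp add: assoc SS right_mult_one_mat[of _ d d])
    finally show ?thesis .
  qed
  moreover have "mat_trace (X * (Y * S)) = mat_trace (S * (X * Y))"
    by (simp add: mat_trace_rotate[of S d])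
  moreover have "mat_trace (S * (Y * X)) = mat_trace (X * (Y * S))"
    by (rule mat_trace_reverse[OF S Y X])
  ultimately have "mat_trace (transpose_mat Z * Z)
      = l\<^sup>2 * mat_trace (X * X) - 2 * l * mat_trace (S * (X * Y)) + mat_trace (Y * Y)"
    unfolding ZT unfolding Z_def
    by (simp add: mat_trace_mult_linear[of _ d] assoc power2_eq_square algebra_simps)
  then show ?thesis using mat_trace_gram_nonneg[OF Z] by simp
qed

text \<open>For Z = l - S the matrix Z X Z is psd, so Tr Z X Z Y >= 0; expand it. Unlike in the
  previous bound, l^2 multiplies Tr X Y, which is zero for orthogonal X and Y.\<close>

lemma mat_trace_involution_psd_le:
  assumes X: "X \<in> psd_mats d" and Y: "Y \<in> psd_mats d" and S: "S \<in> sym_carrier d"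
    and SS: "S * S = 1\<^sub>m d"
  shows "2 * l * mat_trace (S * (X * Y))
    \<le> l\<^sup>2 * mat_trace (X * Y) + (mat_trace (X * X) + mat_trace (Y * Y)) / 2"
proof -
  note Xs = psd_matsD(1)[OF X] and Ys = psd_matsD(1)[OF Y]
  note c[simp] = psd_matsD(2)[OF X] psd_matsD(2)[OF Y] sym_carrierD(1)[OF S]
    mult_carrier_mat[of _ d d _ d] minus_carrier_mat[of _ d d]
  note T = sym_carrierD(2)[OF Xs] sym_carrierD(2)[OF Ys] sym_carrierD(2)[OF S]
  note assoc = assoc_mult_mat[of _ d d _ d _ d]
  define Z where "Z = l \<cdot>\<^sub>m 1\<^sub>m d - S"
  have Z[simp]: "Z \<in> carrier_mat d d" by (simp add: Z_def minus_carrier_mat)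
  have ZT: "transpose_mat Z = Z"
    using symmetric_mat_index[OF c(3) T(3)] carrier_matD[OF c(3)] by (intro eq_matI) (auto simp: Z_def)
  have "mat_trace (X * (S * Y)) = mat_trace (S * (X * Y))"
    using mat_trace_reverse[OF Xs S Ys] mat_trace_rotate[of S d X Y] mat_trace_rotate[of X d Y S]
    by simp
  moreover have "mat_trace (Z * X * Z * Y) =
      l\<^sup>2 * mat_trace (X * Y) - l * mat_trace (S * (X * Y)) - l * mat_trace (X * (S * Y))
      + mat_trace (S * (X * (S * Y)))"
  proof -
    have ZX: "Z * V = l \<cdot>\<^sub>m V - S * V" if "V \<in> carrier_mat d d" for V
      using that by (simp add: Z_def minus_mult_distrib_mat[of _ d d _ _ d] mult_smult_assoc_mat[of _ d d _ d])
    have "mat_trace (Z * X * Z * Y) = mat_trace (Z * (X * (Z * Y)))" by (simp add: assoc)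
    also have "\<dots> = mat_trace ((l \<cdot>\<^sub>m X - S * X) * (l \<cdot>\<^sub>m Y - S * Y))"
      using assoc[of Z X "Z * Y"] by (simp add: ZX)
    finally show ?thesis
      by (simp add: mat_trace_mult_linear[of _ d] assoc power2_eq_square algebra_simps)
  qed
  moreover have "0 \<le> mat_trace (Z * X * Z * Y)"
    using mat_trace_psd_mult_nonneg[OF psd_mats_congruence[OF X Z] Y] by (simp add: ZT)
  moreover have "2 * mat_trace (S * (X * (S * Y))) \<le> mat_trace (X * X) + mat_trace (Y * Y)"
  proof -
    \<comment> \<open>Conjugation by S preserves Tr X^2, and the previous bound, with the identity
      as involution and l = 1, handles Tr W Y.\<close>
    define W where "W = S * X * S"
    have W: "W \<in> sym_carrier d"
      using T by (auto simp: W_def sym_carrier_def transpose_mult[of _ d d _ d] assoc)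
    have "mat_trace (W * W) = mat_trace (X * X)"
    proof -
      have "W * W = S * (X * (S * S) * X * S)" by (simp add: W_def assoc)
      also have "\<dots> = S * (X * X * S)" by (simp add: SS right_mult_one_mat[of _ d d])
      finally have "mat_trace (W * W) = mat_trace (X * X * (S * S))"
        using mat_trace_commute[of S d "X * X * S"] by (simp add: assoc)
      then show ?thesis by (simp add: SS right_mult_one_mat[of _ d d])
    qed
    moreover have "1\<^sub>m d \<in> sym_carrier d" by (simp add: sym_carrier_def)
    ultimately show ?thesis
      using mat_trace_involution_le[OF W Ys, of "1\<^sub>m d" 1] sym_carrierD(1)[OF W]
      by (simp add: W_def assoc left_mult_one_mat[of _ d d])
  qed
  ultimately show ?thesis by (simp add: field_simps)
qed

text \<open>With D = A - B and S its sign, Tr D^2 = Tr A D - Tr B D <= Tr A |D| + Tr B |D|, and the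
  right-hand side equals Tr S (A^2 - B^2).\<close>

lemma powers_stormer_sign:
  assumes A: "A \<in> psd_mats d" and B: "B \<in> psd_mats d"
  obtains S where "S \<in> sym_carrier d" "S * S = 1\<^sub>m d"
    "mat_trace ((A - B) * (A - B)) \<le> mat_trace (S * (A * A)) - mat_trace (S * (B * B))"
proof -
  note c[simp] = psd_matsD(2)[OF A] psd_matsD(2)[OF B]
    mult_carrier_mat[of _ d d _ d] minus_carrier_mat[of _ d d]
  note assoc = assoc_mult_mat[of _ d d _ d _ d]
  have D: "A - B \<in> sym_carrier d"
    using psd_matsD(1)[OF A] psd_matsD(1)[OF B] by (simp add: sym_carrier_def transpose_minus[of _ d d] minus_carrier_mat)
  obtain F :: "(real \<Rightarrow> real) \<Rightarrow> real mat" where F: "\<And>f. F f \<in> sym_carrier d" "\<And>f g. F f * F g = F (\<lambda>x. f x * g x)"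
    "\<And>f g. F f + F g = F (\<lambda>x. f x + g x)" "\<And>f g. F f - F g = F (\<lambda>x. f x - g x)"
    "F (\<lambda>_. 1) = 1\<^sub>m d" "F (\<lambda>x. x) = A - B"
    using symmetric_functional_calculus[OF D] by blast
  note Fc[simp] = sym_carrierD(1)[OF F(1)]
  \<comment> \<open>The value at 0 is 1, not 0, so that S is an involution even if A - B is
    singular.\<close>
  define s :: "real \<Rightarrow> real" where "s x = (if x \<ge> 0 then 1 else -1)" for x
  define S M where "S = F s" and "M = F abs"
  have c'[simp]: "S \<in> carrier_mat d d" "M \<in> carrier_mat d d" by (simp_all add: S_def M_def)
  have abs_s: "abs = (\<lambda>x. s x * x)" "abs = (\<lambda>x. x * s x)" by (auto simp: s_def)
  have M1: "M = S * (A - B)" using F(2)[of s "\<lambda>x. x"] abs_s(1) by (simp add: M_def S_def F(6))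
  have M2: "M = (A - B) * S" using F(2)[of "\<lambda>x. x" s] abs_s(2) by (simp add: M_def S_def F(6))
  have sq: "F (\<lambda>x. sqrt (f x)) * F (\<lambda>x. sqrt (f x)) = F f" if "\<And>x. 0 \<le> f x" for f
    using F(2)[of "\<lambda>x. sqrt (f x)" "\<lambda>x. sqrt (f x)"] that by simp
  \<comment> \<open>The functions |x| + x and |x| - x are nonnegative, so F maps them to squares of
    symmetric matrices.\<close>
  have "0 \<le> mat_trace (B * F (\<lambda>x. \<bar>x\<bar> + x))"
    using mat_trace_mult_sq_nonneg[OF B F(1), of "\<lambda>x. sqrt (\<bar>x\<bar> + x)"] by (subst (asm) sq) auto
  then have "0 \<le> mat_trace (B * M) + mat_trace (B * (A - B))"
    using F(3)[of abs "\<lambda>x. x"] F(6) mat_trace_mult_linear_right(1)[of M d B "A - B"] by (simp add: M_def)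
  moreover have "0 \<le> mat_trace (A * F (\<lambda>x. \<bar>x\<bar> - x))"
    using mat_trace_mult_sq_nonneg[OF A F(1), of "\<lambda>x. sqrt (\<bar>x\<bar> - x)"] by (subst (asm) sq) auto
  then have "0 \<le> mat_trace (A * M) - mat_trace (A * (A - B))"
    using F(4)[of abs "\<lambda>x. x"] F(6) mat_trace_mult_linear_right(2)[of M d A "A - B"] by (simp add: M_def)
  ultimately have "mat_trace ((A - B) * (A - B)) \<le> mat_trace (A * M) + mat_trace (B * M)"
    by (simp add: mat_trace_mult_linear[of _ d])
  \<comment> \<open>M is expanded as S (A - B) here and as (A - B) S next, so that the mixed terms
    Tr A S B cancel in the sum.\<close>
  moreover have "mat_trace (A * M) = mat_trace (S * (A * A)) - mat_trace (A * (S * B))"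
    unfolding M1 using mat_trace_rotate[of A d S A]
    by (simp add: mult_minus_distrib_mat[of _ d d _ d] mat_trace_minus[of _ d])
  moreover have "mat_trace (B * M) = mat_trace (A * (S * B)) - mat_trace (S * (B * B))"
    unfolding M2 using mat_trace_rotate[of B d A S] mat_trace_rotate[of S d B B] mat_trace_rotate[of B d B S]
    by (simp add: minus_mult_distrib_mat[of _ d d _ _ d] mult_minus_distrib_mat[of _ d d _ d]
        mat_trace_minus[of _ d] assoc)
  moreover have "S * S = 1\<^sub>m d"
  proof -
    have "(\<lambda>x. s x * s x) = (\<lambda>_. 1)" by (auto simp: s_def)
    then show ?thesis using F(2)[of s s] F(5) by (simp add: S_def)
  qed
  ultimately show thesis using that[of S] F(1)[of s] by (simp add: S_def)
qed

section \<open>A linear inequality for the Gram matrix of five psd matrices\<close>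

lemma sym_carrier_linear:
  assumes "X \<in> sym_carrier d"
  shows "Y \<in> sym_carrier d \<Longrightarrow> X + Y \<in> sym_carrier d"
    "Y \<in> sym_carrier d \<Longrightarrow> X - Y \<in> sym_carrier d"
    "c \<cdot>\<^sub>m X \<in> sym_carrier d"
proof -
  show "X + Y \<in> sym_carrier d" if "Y \<in> sym_carrier d"
    using assms that by (auto simp: sym_carrier_def transpose_add[of _ d d])
  show "X - Y \<in> sym_carrier d" if "Y \<in> sym_carrier d"
    using assms that by (auto simp: sym_carrier_def transpose_minus[of _ d d] minus_carrier_mat)
  have "transpose_mat (c \<cdot>\<^sub>m X) = c \<cdot>\<^sub>m transpose_mat X" by (intro eq_matI) auto
  then show "c \<cdot>\<^sub>m X \<in> sym_carrier d" using assms by (auto simp: sym_carrier_def)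
qed

text \<open>With \<open>R1 = 5V + C - 3U - P\<close> and \<open>R2 = 5U + C - 3V - Q\<close> this is the expansion of
  \<open>60 Tr (U - V)\<^sup>2 \<le> 100 (Tr R1\<^sup>2 + Tr R2\<^sup>2 + Tr CU + Tr CV + Tr PU + Tr QV)
    + 2 Tr U\<^sup>2 + 2 Tr V\<^sup>2 + Tr C\<^sup>2 + (Tr P\<^sup>2 + Tr Q\<^sup>2) / 2\<close>.\<close>

lemma psd_quintuple_trace_nonneg:
  assumes U: "U \<in> psd_mats d" and V: "V \<in> psd_mats d" and C: "C \<in> psd_mats d"
    and P: "P \<in> psd_mats d" and Q: "Q \<in> psd_mats d"
  defines "t \<equiv> \<lambda>X Y. mat_trace (X * Y)"
  shows "0 \<le> 3342 * (t U U + t V V) + 201 * t C C + 201/2 * (t P P + t Q Q) - 5880 * t U V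
      + 500 * (t C U + t C V) + 700 * (t U P + t V Q) - 1000 * (t V P + t U Q) - 200 * (t C P + t C Q)"
proof -
  obtain S where S: "S \<in> sym_carrier d" and SS: "S * S = 1\<^sub>m d"
    and PS: "t (U - V) (U - V) \<le> t S (U * U) - t S (V * V)"
    using powers_stormer_sign[OF U V] unfolding t_def by blast
  note sym = psd_matsD(1)[OF U] psd_matsD(1)[OF V] psd_matsD(1)[OF C] psd_matsD(1)[OF P] psd_matsD(1)[OF Q]
  note c[simp] = sym[THEN sym_carrierD(1)] sym_carrierD(1)[OF S]
    mult_carrier_mat[of _ d d _ d] minus_carrier_mat[of _ d d]
  note comm = mat_trace_commute[OF c(1,2)] mat_trace_commute[OF c(1,3)] mat_trace_commute[OF c(2,3)]
    mat_trace_commute[OF c(4,1)] mat_trace_commute[OF c(4,2)] mat_trace_commute[OF c(4,3)]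
    mat_trace_commute[OF c(5,1)] mat_trace_commute[OF c(5,2)] mat_trace_commute[OF c(5,3)]
  define R1 R2 where "R1 = 5 \<cdot>\<^sub>m V + C - 3 \<cdot>\<^sub>m U - P" and "R2 = 5 \<cdot>\<^sub>m U + C - 3 \<cdot>\<^sub>m V - Q"
  have R: "R1 \<in> sym_carrier d" "R2 \<in> sym_carrier d"
    by (simp_all add: R1_def R2_def sym sym_carrier_linear)
  \<comment> \<open>Rotation brings R1 and R2 to the front of the product, where the linearity rules
    apply.\<close>
  have rot: "t S (X * Y) = t X (Y * S)" if "X \<in> carrier_mat d d" "Y \<in> carrier_mat d d" for X Y
    unfolding t_def by (rule mat_trace_rotate[OF c(6) that])
  have "t S (R1 * U) = 5 * t S (V * U) + t S (C * U) - 3 * t S (U * U) - t S (P * U)"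
    "t S (R2 * V) = 5 * t S (U * V) + t S (C * V) - 3 * t S (V * V) - t S (Q * V)"
    by (simp_all add: rot sym_carrierD(1)[OF R(1)] sym_carrierD(1)[OF R(2)])
      (simp_all add: t_def R1_def R2_def mat_trace_mult_linear[of _ d])
  moreover have "t S (V * U) = t S (U * V)"
    using mat_trace_reverse[OF S sym(2,1)] mat_trace_rotate[of S d U V] mat_trace_rotate[of U d V S]
    by (simp add: t_def)
  \<comment> \<open>Subtracting the two expansions cancels the terms in U V. Each trace that remains
    has a factor that vanishes in the exact case (R1, R2) or a pair orthogonal there; these get the
    first and the second bound, with l = 10 or -10 according to sign.\<close>
  ultimately have "3 * (t S (U * U) - t S (V * V)) = t S (C * U) - t S (P * U) - t S (R1 * U)
      - t S (C * V) + t S (Q * V) + t S (R2 * V)"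
    by simp
  moreover have "20 * t S (C * U) \<le> 100 * t C U + (t C C + t U U) / 2"
    using mat_trace_involution_psd_le[OF C U S SS, of 10] by (simp add: t_def)
  moreover have "- 20 * t S (P * U) \<le> 100 * t P U + (t P P + t U U) / 2"
    using mat_trace_involution_psd_le[OF P U S SS, of "-10"] by (simp add: t_def)
  moreover have "- 20 * t S (C * V) \<le> 100 * t C V + (t C C + t V V) / 2"
    using mat_trace_involution_psd_le[OF C V S SS, of "-10"] by (simp add: t_def)
  moreover have "20 * t S (Q * V) \<le> 100 * t Q V + (t Q Q + t V V) / 2"
    using mat_trace_involution_psd_le[OF Q V S SS, of 10] by (simp add: t_def)
  moreover have "- 20 * t S (R1 * U) \<le> 100 * t R1 R1 + t U U"
    using mat_trace_involution_le[OF R(1) sym(1) S SS, of "-10"] by (simp add: t_def)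
  moreover have "20 * t S (R2 * V) \<le> 100 * t R2 R2 + t V V"
    using mat_trace_involution_le[OF R(2) sym(2) S SS, of 10] by (simp add: t_def)
  ultimately have "60 * t (U - V) (U - V)
      \<le> 100 * (t R1 R1 + t R2 R2 + t C U + t C V + t P U + t Q V)
        + 2 * t U U + 2 * t V V + t C C + (t P P + t Q Q) / 2"
    using PS by argo
  moreover have "t (U - V) (U - V) = t U U + t V V - 2 * t U V"
    using comm by (simp add: t_def mat_trace_mult_linear[of _ d])
  moreover have "t R1 R1 = 25 * t V V + t C C + 9 * t U U + t P P + 10 * t C V - 30 * t U V
      - 10 * t V P - 6 * t C U - 2 * t C P + 6 * t U P"
    "t R2 R2 = 25 * t U U + t C C + 9 * t V V + t Q Q + 10 * t C U - 30 * t U V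
      - 10 * t U Q - 6 * t C V - 2 * t C Q + 6 * t V Q"
    using comm by (simp_all add: t_def R1_def R2_def mat_trace_mult_linear[of _ d])
  moreover have "t P U = t U P" "t Q V = t V Q" using comm by (simp_all add: t_def)
  ultimately show ?thesis by (simp add: field_simps)
qed

section \<open>Separation of the two cones\<close>

lemma sym_mats_iff: "A \<in> sym_mats \<longleftrightarrow> (\<forall>i j. A $ i $ j = A $ j $ i)"
  unfolding sym_mats_def Finite_Cartesian_Product.transpose_def
  by (simp add: Finite_Cartesian_Product.vec_eq_iff eq_commute)

lemma inner_matrix_vector_mult:
  fixes A :: "real^'n^'n"
  shows "inner x (A *v y) = (\<Sum>i\<in>UNIV. \<Sum>j\<in>UNIV. x $ i * A $ i $ j * y $ j)"
  by (simp add: inner_vec_def matrix_vector_mult_def sum_distrib_left mult.assoc)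

text \<open>Each condition is an equation or a weak inequality between continuous functions of the
  entries.\<close>

lemma closed_DNN: "closed (DNN :: (real^'n^'n) set)"
proof -
  have "DNN = {A :: real^'n^'n. \<forall>i j. A $ j $ i = A $ i $ j} \<inter>
      {A. \<forall>x. 0 \<le> (\<Sum>i\<in>UNIV. \<Sum>j\<in>UNIV. x $ i * A $ i $ j * x $ j)} \<inter>
      {A. \<forall>i j. 0 \<le> A $ i $ j}"
    by (auto simp: DNN_def psd_def sym_mats_iff inner_matrix_vector_mult)
  also have "closed \<dots>"
    by (intro closed_Int closed_Collect_all closed_Collect_eq closed_Collect_le continuous_intros)
  finally show ?thesis .
qed

lemma mat_trace_mult_entrywise:
  assumes "X \<in> psd_mats d" "Y \<in> psd_mats d"
  shows "mat_trace (X * Y) = (\<Sum>kl\<in>{..<d} \<times> {..<d}. X $$ kl * Y $$ kl)"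
proof -
  note X = psd_matsD(2)[OF assms(1)] and Y = psd_matsD[OF assms(2)]
  have "mat_trace (X * Y) = (\<Sum>k<d. \<Sum>l<d. X $$ (k,l) * Y $$ (k,l))"
    unfolding mat_trace_mult[OF X Y(2)]
    using symmetric_mat_index[OF sym_carrierD[OF Y(1)]] by (intro sum.cong refl) simp
  then show ?thesis by (simp add: sum.cartesian_product case_prod_beta)
qed

text \<open>The trace product of symmetric matrices is the Euclidean inner product of their entries,
  so A is a Gram matrix; its entries are nonnegative as traces of products of psd matrices.\<close>

lemma CSP_subset_DNN: "(CSP :: (real^'n^'n) set) \<subseteq> DNN"
proof
  fix A :: "real^'n^'n" assume "A \<in> CSP"
  then obtain d and X :: "'n \<Rightarrow> real mat" where sym: "A \<in> sym_mats"
    and X: "\<And>i. X i \<in> psd_mats d" and A: "\<And>i j. A $ i $ j = mat_trace (X i * X j)"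
    by (auto simp: CSP_def)
  have "0 \<le> inner x (A *v x)" for x
  proof -
    let ?K = "{..<d} \<times> {..<d}"
    have "(\<Sum>kl\<in>?K. (\<Sum>i\<in>UNIV. x $ i * X i $$ kl)\<^sup>2)
        = (\<Sum>kl\<in>?K. \<Sum>i\<in>UNIV. \<Sum>j\<in>UNIV. x $ i * X i $$ kl * (x $ j * X j $$ kl))"
      by (simp add: power2_eq_square sum_product)
    also have "\<dots> = (\<Sum>i\<in>UNIV. \<Sum>kl\<in>?K. \<Sum>j\<in>UNIV. x $ i * X i $$ kl * (x $ j * X j $$ kl))"
      by (rule sum.swap)
    also have "\<dots> = (\<Sum>i\<in>UNIV. \<Sum>j\<in>UNIV. \<Sum>kl\<in>?K. x $ i * X i $$ kl * (x $ j * X j $$ kl))"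
      by (intro sum.cong refl sum.swap)
    also have "\<dots> = inner x (A *v x)"
      unfolding inner_matrix_vector_mult A mat_trace_mult_entrywise[OF X X]
      by (simp add: sum_distrib_left sum_distrib_right mult_ac)
    finally show ?thesis by (metis (no_types, lifting) sum_nonneg zero_le_power2)
  qed
  then show "A \<in> DNN"
    using sym A mat_trace_psd_mult_nonneg[OF X X] by (auto simp: DNN_def psd_def)
qed

lemma dual_cone_antimono: "K \<subseteq> L \<Longrightarrow> dual_cone L \<subseteq> dual_cone K"
  by (auto simp: dual_cone_def)

section \<open>A matrix separating a point of \<open>DNN\<close> from \<open>CSP\<close>\<close>

lemma gram_matrix_psd:
  fixes w :: "'n::finite \<Rightarrow> 'a::real_inner"
  shows "psd (\<chi> i j. inner (w i) (w j))"
proof -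
  have "0 \<le> inner x ((\<chi> i j. inner (w i) (w j)) *v x)" for x :: "real^'n"
  proof -
    have "inner x ((\<chi> i j. inner (w i) (w j)) *v x)
        = inner (\<Sum>i\<in>UNIV. x $ i *\<^sub>R w i) (\<Sum>j\<in>UNIV. x $ j *\<^sub>R w j)"
      unfolding inner_matrix_vector_mult
      by (subst sum.swap) (simp add: inner_sum_left inner_sum_right sum_distrib_left mult_ac)
    then show ?thesis by simp
  qed
  then show ?thesis
    by (simp add: psd_def sym_mats_iff inner_commute)
qed

text \<open>Symmetrized so that it lies in \<open>sym_mats\<close>, where the dual is taken, and
  halved so that pairing it with a symmetric matrix reads off one entry, also for i = j.\<close>

definition entry_mat :: "'n \<Rightarrow> 'n \<Rightarrow> real^'n^'n" where
  "entry_mat i j = (\<chi> k l. (of_bool (k = i \<and> l = j) + of_bool (k = j \<and> l = i)) / 2)"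

lemma trace_entry_mat_mult:
  fixes Y :: "real^'n^'n"
  assumes "Y \<in> sym_mats"
  shows "trace (entry_mat i j ** Y) = Y $ i $ j"
proof -
  have Y: "Y $ j $ i = Y $ i $ j"
    using assms by (simp add: sym_mats_iff)
  have "trace (entry_mat i j ** Y) =
      (\<Sum>k\<in>UNIV. \<Sum>l\<in>UNIV. (of_bool (k = i) * (of_bool (l = j) * Y $ l $ k)
        + of_bool (k = j) * (of_bool (l = i) * Y $ l $ k)) / 2)"
    unfolding trace_def matrix_matrix_mult_def entry_mat_def
    by (auto intro!: sum.cong simp: of_bool_conj algebra_simps)
  also have "\<dots> = (Y $ j $ i + Y $ i $ j) / 2"
    by (simp add: sum.distrib flip: sum_divide_distrib sum_distrib_left)
  finally show ?thesis using Y by simp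
qed

lemma trace_mult_linear:
  fixes X Y Z :: "real^'n^'n"
  shows "trace ((X + Y) ** Z) = trace (X ** Z) + trace (Y ** Z)"
    "trace ((X - Y) ** Z) = trace (X ** Z) - trace (Y ** Z)"
    "trace ((c *\<^sub>R X) ** Z) = c * trace (X ** Z)"
  by (simp_all add: trace_def matrix_matrix_mult_def algebra_simps sum.distrib sum_subtractf sum_distrib_left)

lemma sym_mats_linear:
  fixes X Y :: "real^'n^'n"
  shows "X \<in> sym_mats \<Longrightarrow> Y \<in> sym_mats \<Longrightarrow> X + Y \<in> sym_mats"
    "X \<in> sym_mats \<Longrightarrow> Y \<in> sym_mats \<Longrightarrow> X - Y \<in> sym_mats"
    "X \<in> sym_mats \<Longrightarrow> c *\<^sub>R X \<in> sym_mats"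
    "entry_mat i j \<in> sym_mats"
  by (auto simp: sym_mats_iff entry_mat_def add.commute conj_commute)

lemma CSP_DNN_separation:
  assumes "CARD('n::finite) \<ge> 5"
  obtains T A :: "real^'n^'n" where "T \<in> dual_cone CSP" "A \<in> DNN" "trace (T ** A) < 0"
proof -
  obtain K :: "'n set" where "card K = 5" "finite K"
    using obtain_subset_with_card_n[OF assms] by auto
  then obtain xs where "distinct xs" "length xs = 5" "set xs = K"
    using finite_distinct_list distinct_card by metis
  then obtain u v c p q :: 'n where "distinct [u, v, c, p, q]"
    by (auto simp: length_Suc_conv numeral_eq_Suc)
  then have [simp]: "u \<noteq> v" "u \<noteq> c" "u \<noteq> p" "u \<noteq> q" "v \<noteq> c" "v \<noteq> p" "v \<noteq> q" "c \<noteq> p" "c \<noteq> q" "p \<noteq> q"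
    "v \<noteq> u" "c \<noteq> u" "p \<noteq> u" "q \<noteq> u" "c \<noteq> v" "p \<noteq> v" "q \<noteq> v" "p \<noteq> c" "q \<noteq> c" "q \<noteq> p"
    by auto
  let ?e = "entry_mat :: 'n \<Rightarrow> 'n \<Rightarrow> real^'n^'n"
  \<comment> \<open>The coefficients are those of \<open>psd_quintuple_trace_nonneg\<close>; indices
    outside the five chosen ones get weight zero.\<close>
  define T where "T = 3342 *\<^sub>R (?e u u + ?e v v) + 201 *\<^sub>R ?e c c + (201/2) *\<^sub>R (?e p p + ?e q q)
    - 5880 *\<^sub>R ?e u v + 500 *\<^sub>R (?e c u + ?e c v) + 700 *\<^sub>R (?e u p + ?e v q)
    - 1000 *\<^sub>R (?e v p + ?e u q) - 200 *\<^sub>R (?e c p + ?e c q)"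
  have T: "trace (T ** Y) = 3342 * (Y$u$u + Y$v$v) + 201 * Y$c$c + 201/2 * (Y$p$p + Y$q$q)
      - 5880 * Y$u$v + 500 * (Y$c$u + Y$c$v) + 700 * (Y$u$p + Y$v$q)
      - 1000 * (Y$v$p + Y$u$q) - 200 * (Y$c$p + Y$c$q)" if "Y \<in> sym_mats" for Y
    unfolding T_def trace_mult_linear trace_entry_mat_mult[OF that] ..
  have "T \<in> sym_mats" unfolding T_def by (intro sym_mats_linear)
  moreover have "0 \<le> trace (T ** Y)" if "Y \<in> CSP" for Y
  proof -
    obtain d and X :: "'n \<Rightarrow> real mat" where "Y \<in> sym_mats" "\<And>i. X i \<in> psd_mats d"
      and "\<And>i j. Y $ i $ j = mat_trace (X i * X j)"
      using \<open>Y \<in> CSP\<close> by (auto simp: CSP_def)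
    then show ?thesis
      using psd_quintuple_trace_nonneg[of "X u" d "X v" "X c" "X p" "X q"] by (simp only: T)
  qed
  ultimately have "T \<in> dual_cone CSP" by (simp add: dual_cone_def)
  \<comment> \<open>The remaining indices get the zero vector, which keeps A in \<open>DNN\<close>
    for every order n >= 5.\<close>
  moreover define w :: "'n \<Rightarrow> real \<times> real \<times> real" where
    "w i = (if i = u then (2, 1, 0) else if i = v then (2, -1, 0) else if i = c then (0, 0, 8)
      else if i = p then (4, -8, 8) else if i = q then (4, 8, 8) else 0)" for i
  define A :: "real^'n^'n" where "A = (\<chi> i j. inner (w i) (w j))"
  have "A \<in> DNN"
    using gram_matrix_psd[of w] by (auto simp: DNN_def A_def w_def)
  \<comment> \<open>The value is 2 (5 + 5) + 64 + 144 - 60 |u - v|^2 = 228 - 240 = -12, since the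
    linear relations and the orthogonalities hold exactly.\<close>
  moreover have "trace (T ** A) < 0"
  proof -
    have "A \<in> sym_mats" using \<open>A \<in> DNN\<close> by (simp add: DNN_def psd_def)
    then show ?thesis by (simp add: T) (simp add: A_def w_def)
  qed
  ultimately show thesis by (rule that)
qed

theorem corollary3p12:
  assumes "CARD('n::finite) \<ge> 5"
  shows "closure (CSP :: (real^'n^'n) set) \<subset> DNN \<and>
         dual_cone (DNN :: (real^'n^'n) set) \<subset> dual_cone CSP"
proof -
  obtain T A :: "real^'n^'n" where T: "T \<in> dual_cone CSP" and A: "A \<in> DNN" and neg: "trace (T ** A) < 0"
    using CSP_DNN_separation[OF assms] .
  \<comment> \<open>The half-space given by T is closed, so nonnegativity passes from
    \<open>CSP\<close> to its closure.\<close>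
  have "closure CSP \<subseteq> {Y :: real^'n^'n. 0 \<le> trace (T ** Y)}"
  proof (rule closure_minimal)
    show "CSP \<subseteq> {Y. 0 \<le> trace (T ** Y)}" using T by (auto simp: dual_cone_def)
    show "closed {Y :: real^'n^'n. 0 \<le> trace (T ** Y)}"
      unfolding trace_def matrix_matrix_mult_def
      by (simp, intro closed_Collect_le continuous_intros)
  qed
  then have "A \<notin> closure CSP" using neg by auto
  moreover have "closure CSP \<subseteq> (DNN :: (real^'n^'n) set)"
    by (rule closure_minimal[OF CSP_subset_DNN closed_DNN])
  moreover have "T \<notin> dual_cone DNN" using A neg by (auto simp: dual_cone_def intro!: bexI[of _ A])
  ultimately show ?thesis
    using A T dual_cone_antimono[OF CSP_subset_DNN] by blast
qed

end
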